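(* Let $\mathbb{S}$ be a SIC set in $\mathbb{CP}^2$ containing the two points $[\mathbf z_1],[\mathbf z_2]$, where $$\mathbf z_1=\tfrac1{\sqrt2}(0,1,-\omega),\qquad \mathbf z_2=\tfrac1{\sqrt2}(0,1,-\omega^2),\qquad \omega=e^{2\pi i/3}.$$ Then for every other point $[\mathbf z]$ of $\mathbb{S}$ (that is, $[\mathbf z]\in\mathbb S\setminus\{[\mathbf z_1],[\mathbf z_2]\}$) one has $\mu([\mathbf z])\in\mathscr C$. Indeed, $[\mathbf z]$ is represented by a unit vector of the form $$\mathbf z(\sigma,\phi)=\sqrt{\tfrac23}\,\Big(e^{i\sigma}\cos\phi,\ \cos(\phi+\tfrac23\pi),\ \cos(\phi+\tfrac43\pi)\Big)$$ for some $\sigma\in(-\pi,\pi]$ and some $\phi\in(-\tfrac12\pi,\tfrac12\pi]$.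
   Context: For $\mathbf z\in\mathbb C^3\setminus\{0\}$, $[\mathbf z]$ denotes the corresponding point of $\mathbb{CP}^2$, and $\langle\mathbf w,\mathbf z\rangle=\sum_i\overline{w_i}z_i$. A SIC set in $\mathbb{CP}^2$ is a set of nine distinct points, represented by unit vectors $\mathbf z_1,\dots,\mathbf z_9$, which are mutually equidistant: $|\langle\mathbf z_i,\mathbf z_j\rangle|^2=\kappa$ for all $i\neq j$, for some fixed $\kappa\in[0,1)$ (necessarily $\kappa=1/4$). The moment map $\mu:\mathbb{CP}^2\to\mathbb R^3$ is $\mu([\mathbf z])=\|\mathbf z\|^{-2}(|z_1|^2,|z_2|^2,|z_3|^2)$. The circle $\mathscr C\subset\mathbb R^3$ is the intersection of the plane $x_1+x_2+x_3=1$ with the sphere $x_1^2+x_2^2+x_3^2=\tfrac12$. *)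

theory Defs
  imports "HOL-Analysis.Analysis"
begin

text \<open>The complex projective plane: nonzero vectors of \<open>complex ^ 3\<close> up to complex multiples.
  The relation is partial because the zero vector represents no point.\<close>

definition same_line :: "complex ^ 3 \<Rightarrow> complex ^ 3 \<Rightarrow> bool" where
  "same_line w z \<longleftrightarrow> w \<noteq> 0 \<and> z \<noteq> 0 \<and> (\<exists>c. w = c *s z)"

lemma same_line_part_equivp: "part_equivp same_line"
proof (rule part_equivpI)
  show "\<exists>x. same_line x x"
    unfolding same_line_def by (intro exI[of _ "axis 1 1"] conjI exI[of _ 1]) (simp_all add: axis_eq_0_iff)
  show "symp same_line"
  proof (rule sympI)
    fix w z assume "same_line w z"
    then obtain c where c: "w \<noteq> 0" "z \<noteq> 0" "w = c *s z" unfolding same_line_def by blast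
    then have "c \<noteq> 0" by auto
    then have "z = inverse c *s w" using c(3) by (simp add: vector_smult_assoc)
    then show "same_line z w" using c unfolding same_line_def by blast
  qed
  show "transp same_line"
    unfolding same_line_def by (rule transpI) (metis vector_smult_assoc)
qed

quotient_type cp2 = "complex ^ 3" / partial: same_line
  by (rule same_line_part_equivp)

text \<open>The point \<open>[z]\<close>; meaningful only for \<open>z \<noteq> 0\<close>.\<close>

definition cp2_point :: "complex ^ 3 \<Rightarrow> cp2" where
  "cp2_point z = abs_cp2 z"

lemma cp2_point_eq_iff:
  assumes "w \<noteq> 0" "z \<noteq> 0"
  shows "cp2_point w = cp2_point z \<longleftrightarrow> (\<exists>c. w = c *s z)"
proof -
  have "same_line w w" "same_line z z"
    using assms unfolding same_line_def by (metis vector_smult_lid)+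
  then have "cp2_point w = cp2_point z \<longleftrightarrow> same_line w z"
    unfolding cp2_point_def using Quotient3_rel[OF Quotient3_cp2] by blast
  then show ?thesis using assms by (simp add: same_line_def)
qed

text \<open>The library's \<open>inner\<close> on \<open>complex ^ 3\<close> is the real part of this product.\<close>

definition herm :: "complex ^ 3 \<Rightarrow> complex ^ 3 \<Rightarrow> complex" where
  "herm w z = (\<Sum>i\<in>UNIV. cnj (w $ i) * z $ i)"

definition SIC_set :: "cp2 set \<Rightarrow> bool" where
  "SIC_set S \<longleftrightarrow>
    (\<exists>(z :: nat \<Rightarrow> complex ^ 3) \<kappa>.
       (\<forall>i\<in>{1..9}. norm (z i) = 1) \<and>
       inj_on (\<lambda>i. cp2_point (z i)) {1..9} \<and>
       S = (\<lambda>i. cp2_point (z i)) ` {1..9} \<and>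
       0 \<le> \<kappa> \<and> \<kappa> < 1 \<and>
       (\<forall>i\<in>{1..9}. \<forall>j\<in>{1..9}. i \<noteq> j \<longrightarrow> (cmod (herm (z i) (z j)))\<^sup>2 = \<kappa>))"

lift_definition moment_map :: "cp2 \<Rightarrow> real ^ 3" is
  "\<lambda>z. \<chi> i. (cmod (z $ i))\<^sup>2 / (norm z)\<^sup>2"
proof -
  fix w z assume "same_line w z"
  then obtain c where c: "w \<noteq> 0" "w = c *s z" unfolding same_line_def by blast
  then have "c \<noteq> 0" by auto
  moreover have "norm w = cmod c * norm z"
    unfolding c(2) norm_vec_def by (simp add: norm_mult L2_set_right_distrib)
  ultimately show "(\<chi> i. (cmod (w $ i))\<^sup>2 / (norm w)\<^sup>2) = (\<chi> i. (cmod (z $ i))\<^sup>2 / (norm z)\<^sup>2)"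
    by (simp add: c(2) norm_mult power_mult_distrib vec_eq_iff)
qed

definition circle_C :: "(real ^ 3) set" where
  "circle_C = {x. x $ 1 + x $ 2 + x $ 3 = 1} \<inter> {x. (x $ 1)\<^sup>2 + (x $ 2)\<^sup>2 + (x $ 3)\<^sup>2 = 1 / 2}"

definition omega :: complex where
  "omega = exp (2 * of_real pi * \<i> / 3)"

definition z1 :: "complex ^ 3" where
  "z1 = complex_of_real (1 / sqrt 2) *s vector [0, 1, - omega]"

definition z2 :: "complex ^ 3" where
  "z2 = complex_of_real (1 / sqrt 2) *s vector [0, 1, - omega\<^sup>2]"

definition z_param :: "real \<Rightarrow> real \<Rightarrow> complex ^ 3" where
  "z_param \<sigma> \<phi> = complex_of_real (sqrt (2 / 3)) *s
     vector [exp (\<i> * of_real \<sigma>) * of_real (cos \<phi>),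
             of_real (cos (\<phi> + 2 / 3 * pi)),
             of_real (cos (\<phi> + 4 / 3 * pi))]"

end

theory Submission
  imports Defs
begin

text \<open>Since \<open>|\<langle>z\<^sub>1, z\<^sub>2\<rangle>|\<^sup>2 = 1/4\<close>, the common value \<open>\<kappa>\<close> is \<open>1/4\<close>. For a unit vector \<open>(a, b, c)\<close> the
  conditions \<open>|\<langle>z\<^sub>1, z\<rangle>|\<^sup>2 = |\<langle>z\<^sub>2, z\<rangle>|\<^sup>2 = 1/4\<close> differ by the sign of \<open>Im (cnj b * c)\<close>; hence that
  imaginary part vanishes, \<open>b\<close> and \<open>c\<close> become real after a change of phase, and then
  \<open>b\<^sup>2 + b c + c\<^sup>2 = 1/2\<close> is an ellipse parametrised by \<open>\<phi>\<close>. Its points with \<open>|a|\<^sup>2 = 1/2 + b c\<close> have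
  moments whose second elementary symmetric function is \<open>1/4\<close>, which is the equation of the circle.\<close>

section \<open>Coordinates, norms and mutual distance of the two given points\<close>

lemma omega_eq: "omega = Complex (- 1 / 2) (sqrt 3 / 2)"
proof -
  have "omega = cis (2 * pi / 3)"
    by (simp add: omega_def cis_conv_exp mult.commute)
  then show ?thesis
    by (simp add: complex_eq_iff cos_120 sin_120)
qed

lemma omega_sq_eq: "omega\<^sup>2 = cnj omega"
  by (simp add: omega_eq complex_eq_iff power2_eq_square)

lemma cmod_omega: "cmod omega = 1"
  by (simp add: omega_def norm_exp_eq_Re)

lemma z1_nth:
  "z1 $ 1 = 0" "z1 $ 2 = of_real (1 / sqrt 2)" "z1 $ 3 = - of_real (1 / sqrt 2) * omega"
  by (simp_all add: z1_def)

lemma z2_nth: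
  "z2 $ 1 = 0" "z2 $ 2 = of_real (1 / sqrt 2)" "z2 $ 3 = - of_real (1 / sqrt 2) * cnj omega"
  by (simp_all add: z2_def omega_sq_eq)

lemma norm_vec3_sq:
  fixes z :: "complex ^ 3"
  shows "(norm z)\<^sup>2 = (cmod (z $ 1))\<^sup>2 + (cmod (z $ 2))\<^sup>2 + (cmod (z $ 3))\<^sup>2"
  by (simp add: norm_vec_def L2_set_def sum_3)

lemma herm_smult: "herm (c *s w) (d *s z) = cnj c * d * herm w z"
  by (simp add: herm_def sum_distrib_left algebra_simps)

lemma norm_smult_vec3: "norm (c *s (z :: complex ^ 3)) = cmod c * norm z"
  by (simp add: norm_vec_def norm_mult L2_set_right_distrib)

lemma cmod_herm_z1_sq: "(cmod (herm z1 z))\<^sup>2 = (cmod (z $ 2 - cnj omega * z $ 3))\<^sup>2 / 2"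
proof -
  have "herm z1 z = complex_of_real (1 / sqrt 2) * (z $ 2 - cnj omega * z $ 3)"
    by (simp add: herm_def z1_nth sum_3 algebra_simps)
  then show ?thesis
    by (simp add: norm_mult norm_divide power_mult_distrib power_divide)
qed

lemma cmod_herm_z2_sq: "(cmod (herm z2 z))\<^sup>2 = (cmod (z $ 2 - omega * z $ 3))\<^sup>2 / 2"
proof -
  have "herm z2 z = complex_of_real (1 / sqrt 2) * (z $ 2 - omega * z $ 3)"
    by (simp add: herm_def z2_nth sum_3 algebra_simps)
  then show ?thesis
    by (simp add: norm_mult norm_divide power_mult_distrib power_divide)
qed

lemma norm_z1: "norm z1 = 1"
proof -
  have "(norm z1)\<^sup>2 = 1"
    by (simp add: norm_vec3_sq z1_nth norm_mult norm_divide power_divide cmod_omega)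
  then show ?thesis
    using norm_ge_zero[of z1] by (simp add: power2_eq_1_iff)
qed

lemma norm_z2: "norm z2 = 1"
proof -
  have "(norm z2)\<^sup>2 = 1"
    by (simp add: norm_vec3_sq z2_nth norm_mult norm_divide power_divide cmod_omega)
  then show ?thesis
    using norm_ge_zero[of z2] by (simp add: power2_eq_1_iff)
qed

lemma cmod_herm_z1_z2_sq: "(cmod (herm z1 z2))\<^sup>2 = 1 / 4"
proof -
  \<comment> \<open>Here \<open>cnj (omega\<^sup>2)\<close> is \<open>omega\<close>, and
    \<open>1 + omega\<close> is a primitive sixth root of unity, hence of modulus 1; only the scalar
    factors contribute to 1/4.\<close>
  have "z2 $ 2 - cnj omega * z2 $ 3 = of_real (1 / sqrt 2) * (1 + cnj (omega\<^sup>2))"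
    by (simp add: z2_nth power2_eq_square add_divide_distrib)
  also have "1 + cnj (omega\<^sup>2) = Complex (1 / 2) (sqrt 3 / 2)"
    unfolding omega_sq_eq by (simp add: omega_eq complex_eq_iff)
  finally show ?thesis
    unfolding cmod_herm_z1_sq
    by (simp add: norm_mult norm_divide power_mult_distrib power_divide cmod_power2)
qed

lemma cp2_point_z1_neq_z2: "cp2_point z1 \<noteq> cp2_point z2"
proof
  assume "cp2_point z1 = cp2_point z2"
  moreover have "z1 \<noteq> 0" "z2 \<noteq> 0"
    using norm_z1 norm_z2 by auto
  ultimately obtain c where c: "z1 = c *s z2"
    using cp2_point_eq_iff by blast
  \<comment> \<open>Equal nonzero second coordinates force \<open>c = 1\<close>; the third
    coordinates would then make \<open>omega\<close> real.\<close>
  then have "z1 $ 2 = c * z2 $ 2" "z1 $ 3 = c * z2 $ 3"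
    by (metis vector_smult_component)+
  then show False
    by (auto simp: z1_nth z2_nth omega_eq complex_eq_iff)
qed

section \<open>Moments and phase normalisation\<close>

lemma moment_map_unit:
  assumes "norm z = 1"
  shows "moment_map (cp2_point z) = (\<chi> i. (cmod (z $ i))\<^sup>2)"
proof -
  have "same_line z z"
    using assms unfolding same_line_def by (metis norm_zero vector_smult_lid zero_neq_one)
  then show ?thesis
    using assms by (simp add: cp2_point_def moment_map.abs_eq)
qed

text \<open>If \<open>b\<close> is nonzero, its phase also serves for \<open>c\<close>, because
  \<open>cnj b * c\<close> is real. This leaves the sign of \<open>u\<close> free, and the last
  condition fixes it: \<open>- (\<beta> + \<gamma>)\<close> will have to be a modulus, and the
  tie-break selects the end pi/2 of the half-open range of angles instead of -pi/2.\<close>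

lemma common_phase:
  fixes b c :: complex
  assumes "Im (cnj b * c) = 0"
  obtains u :: complex and \<beta> \<gamma> :: real
  where "cmod u = 1" "b = u * of_real \<beta>" "c = u * of_real \<gamma>"
    "\<beta> + \<gamma> < 0 \<or> \<beta> + \<gamma> = 0 \<and> \<gamma> \<ge> 0"
proof -
  have "\<exists>u \<beta> \<gamma>. cmod u = 1 \<and> b = u * of_real \<beta> \<and> c = u * of_real \<gamma>"
  proof (cases "b = 0")
    case True
    then show ?thesis
      using rcis_cmod_Arg[of c]
      by (intro exI[of _ "cis (Arg c)"] exI[of _ 0] exI[of _ "cmod c"]) (simp add: rcis_def mult.commute)
  next
    case False
    define u where "u = sgn b"
    have u: "cmod u = 1"
      using False by (simp add: u_def norm_sgn)
    have b: "b = u * of_real (cmod b)"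
      using False by (simp add: u_def sgn_eq)
    have "cnj b * c = of_real (Re (cnj b * c))"
      using assms by (simp add: complex_eq_iff)
    then have "cnj u * c = of_real (Re (cnj b * c) / cmod b)"
      using False by (simp add: u_def sgn_eq)
    moreover have "c = u * (cnj u * c)"
      using u complex_norm_square[of u] by (simp flip: mult.assoc)
    ultimately have "c = u * of_real (Re (cnj b * c) / cmod b)"
      by simp
    then show ?thesis
      using u b by blast
  qed
  then obtain u \<beta> \<gamma> where u: "cmod u = 1" "b = u * of_real \<beta>" "c = u * of_real \<gamma>"
    by blast
  show thesis
  proof (cases "\<beta> + \<gamma> < 0 \<or> \<beta> + \<gamma> = 0 \<and> \<gamma> \<ge> 0")
    case True
    then show thesis using that u by blast
  next
    case False
    then show thesis using that[of "- u" "- \<beta>" "- \<gamma>"] u by fastforce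
  qed
qed

section \<open>Parametrisation of the ellipse by an angle\<close>

lemma cos_add_thirds:
  "cos (\<phi> + 2 / 3 * pi) = - cos \<phi> / 2 - sqrt 3 / 2 * sin \<phi>"
  "cos (\<phi> + 4 / 3 * pi) = - cos \<phi> / 2 + sqrt 3 / 2 * sin \<phi>"
proof -
  have *: "cos (2 / 3 * pi) = - 1 / 2" "sin (2 / 3 * pi) = sqrt 3 / 2"
    using cos_120 sin_120 by simp_all
  have "4 / 3 * pi = 2 * (2 / 3 * pi)"
    by simp
  then have "cos (4 / 3 * pi) = - 1 / 2" "sin (4 / 3 * pi) = - sqrt 3 / 2"
    by (simp_all only: cos_double sin_double *) (simp_all add: power2_eq_square)
  then show "cos (\<phi> + 2 / 3 * pi) = - cos \<phi> / 2 - sqrt 3 / 2 * sin \<phi>"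
    "cos (\<phi> + 4 / 3 * pi) = - cos \<phi> / 2 + sqrt 3 / 2 * sin \<phi>"
    using * by (simp_all only: cos_add) simp_all
qed

text \<open>The angle is determined by \<open>cos \<phi> = - (\<beta> + \<gamma>) / sqrt (2 / 3)\<close>, as the three cosines sum to zero,
  and \<open>sin \<phi> = (\<gamma> - \<beta>) / sqrt 2\<close>; the sign condition puts it in the right half circle.\<close>
lemma ellipse_angle:
  fixes \<beta> \<gamma> :: real
  assumes ell: "\<beta>\<^sup>2 + \<gamma>\<^sup>2 + \<beta> * \<gamma> = 1 / 2"
    and sign: "\<beta> + \<gamma> < 0 \<or> \<beta> + \<gamma> = 0 \<and> \<gamma> \<ge> 0"
  obtains \<phi> where "\<phi> \<in> {-(pi/2)<..pi/2}"
    "\<beta> = sqrt (2 / 3) * cos (\<phi> + 2 / 3 * pi)"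
    "\<gamma> = sqrt (2 / 3) * cos (\<phi> + 4 / 3 * pi)"
    "sqrt (2 / 3) * cos \<phi> = - (\<beta> + \<gamma>)"
proof -
  define Y where "Y = (\<gamma> - \<beta>) / sqrt 2"
  define X where "X = - (\<beta> + \<gamma>) * sqrt (3 / 2)"
  have Y2: "Y\<^sup>2 = (\<gamma> - \<beta>)\<^sup>2 / 2" and X2: "X\<^sup>2 = (\<beta> + \<gamma>)\<^sup>2 * (3 / 2)"
    by (simp_all add: Y_def X_def power_divide power_mult_distrib power2_commute add.commute)
  \<comment> \<open>Rescaling along the axes of the ellipse turns it into the unit circle.\<close>
  have XY: "X\<^sup>2 = 1 - Y\<^sup>2"
    unfolding X2 Y2 using ell by (simp add: power2_eq_square field_simps)
  have X0: "X \<ge> 0"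
    using sign unfolding X_def by (intro mult_nonneg_nonneg) auto
  have "Y\<^sup>2 \<le> 1"
    using XY zero_le_power2[of X] by linarith
  then have Y1: "-1 \<le> Y" "Y \<le> 1"
    using abs_square_le_1[of Y] by linarith+
  \<comment> \<open>\<open>arcsin\<close> takes values in the closed interval, so only its left end
    has to be excluded. There the cosine vanishes and the tie-break in \<open>sign\<close>
    applies.\<close>
  have "Y \<noteq> -1"
  proof
    assume Y: "Y = -1"
    then have "X = 0"
      using XY by simp
    then have "\<beta> + \<gamma> = 0"
      by (simp add: X_def)
    then have "Y \<ge> 0"
      using sign by (simp add: Y_def)
    with Y show False by simp
  qed
  define \<phi> where "\<phi> = arcsin Y"
  have sin: "sin \<phi> = Y"
    using Y1 by (simp add: \<phi>_def)
  have cos: "cos \<phi> = X"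
    using Y1 X0 by (simp add: \<phi>_def cos_arcsin flip: XY)
  have range: "\<phi> \<in> {-(pi/2)<..pi/2}"
  proof -
    have "\<phi> \<noteq> - (pi / 2)"
      using sin \<open>Y \<noteq> -1\<close> by auto
    then show ?thesis
      using arcsin_bounded[OF Y1] by (auto simp: \<phi>_def)
  qed
  have X': "sqrt (2 / 3) * X = - (\<beta> + \<gamma>)"
    by (simp add: X_def real_sqrt_divide)
  have Y': "sqrt (2 / 3) * (sqrt 3 / 2 * Y) = (\<gamma> - \<beta>) / 2"
    by (simp add: Y_def real_sqrt_divide)
  show thesis
  proof (rule that[OF range])
    have "sqrt (2 / 3) * cos (\<phi> + 2 / 3 * pi) = - (sqrt (2 / 3) * X) / 2 - sqrt (2 / 3) * (sqrt 3 / 2 * Y)"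
      unfolding cos_add_thirds sin cos by (simp add: right_diff_distrib distrib_left)
    then show "\<beta> = sqrt (2 / 3) * cos (\<phi> + 2 / 3 * pi)"
      unfolding X' Y' by (simp add: field_simps)
    have "sqrt (2 / 3) * cos (\<phi> + 4 / 3 * pi) = - (sqrt (2 / 3) * X) / 2 + sqrt (2 / 3) * (sqrt 3 / 2 * Y)"
      unfolding cos_add_thirds sin cos by (simp add: right_diff_distrib distrib_left)
    then show "\<gamma> = sqrt (2 / 3) * cos (\<phi> + 4 / 3 * pi)"
      unfolding X' Y' by (simp add: field_simps)
    show "sqrt (2 / 3) * cos \<phi> = - (\<beta> + \<gamma>)"
      using X' cos by simp
  qed
qed

section \<open>Unit vectors equidistant from the two points\<close>

lemma equidistant_imp_ellipse:
  fixes b c :: complex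
  assumes "(cmod (b - cnj omega * c))\<^sup>2 = 1 / 2" and "(cmod (b - omega * c))\<^sup>2 = 1 / 2"
  shows "Im (cnj b * c) = 0" and "(cmod b)\<^sup>2 + (cmod c)\<^sup>2 + Re (cnj b * c) = 1 / 2"
proof -
  \<comment> \<open>This is used at \<open>omega\<close> and its conjugate. Their real parts agree
    and their imaginary parts are opposite, so the two instances differ only in the sign of the term
    with \<open>Im (cnj b * c)\<close>.\<close>
  have exp: "(cmod (b - w * c))\<^sup>2 = (cmod b)\<^sup>2 + (cmod w * cmod c)\<^sup>2 - 2 * Re (w * (cnj b * c))" for w
    unfolding norm_mult[symmetric] cmod_power2 by (simp add: power2_eq_square algebra_simps)
  have 1: "(cmod b)\<^sup>2 + (cmod c)\<^sup>2 + Re (cnj b * c) - sqrt 3 * Im (cnj b * c) = 1 / 2"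
    using assms(1) unfolding exp complex_mod_cnj cmod_omega by (simp add: omega_eq algebra_simps)
  have 2: "(cmod b)\<^sup>2 + (cmod c)\<^sup>2 + Re (cnj b * c) + sqrt 3 * Im (cnj b * c) = 1 / 2"
    using assms(2) unfolding exp cmod_omega by (simp add: omega_eq algebra_simps)
  have "sqrt 3 * Im (cnj b * c) = 0"
    using 1 2 by linarith
  then show "Im (cnj b * c) = 0"
    by simp
  then show "(cmod b)\<^sup>2 + (cmod c)\<^sup>2 + Re (cnj b * c) = 1 / 2"
    using 1 by simp
qed

lemma equidistant_from_z1_z2:
  assumes z: "norm z = 1"
    and h1: "(cmod (herm z1 z))\<^sup>2 = 1 / 4" and h2: "(cmod (herm z2 z))\<^sup>2 = 1 / 4"
  shows "moment_map (cp2_point z) \<in> circle_C"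
    and "\<exists>\<sigma>\<in>{-pi<..pi}. \<exists>\<phi>\<in>{-(pi/2)<..pi/2}.
           norm (z_param \<sigma> \<phi>) = 1 \<and> cp2_point z = cp2_point (z_param \<sigma> \<phi>)"
proof -
  have e1: "(cmod (z $ 2 - cnj omega * z $ 3))\<^sup>2 = 1 / 2"
    and e2: "(cmod (z $ 2 - omega * z $ 3))\<^sup>2 = 1 / 2"
    using h1 h2 by (simp_all add: cmod_herm_z1_sq cmod_herm_z2_sq)
  note ell = equidistant_imp_ellipse[OF e1 e2]
  obtain u \<beta> \<gamma> where u: "cmod u = 1" and b: "z $ 2 = u * of_real \<beta>" and c: "z $ 3 = u * of_real \<gamma>"
    and sign: "\<beta> + \<gamma> < 0 \<or> \<beta> + \<gamma> = 0 \<and> \<gamma> \<ge> 0"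
    using common_phase[OF ell(1)] .
  have uu: "u * cnj u = 1"
    using u complex_norm_square[of u] by simp
  have nb: "(cmod (z $ 2))\<^sup>2 = \<beta>\<^sup>2" and nc: "(cmod (z $ 3))\<^sup>2 = \<gamma>\<^sup>2"
    by (simp_all add: b c norm_mult u)
  have "cnj (z $ 2) * z $ 3 = (u * cnj u) * of_real (\<beta> * \<gamma>)"
    by (simp add: b c)
  then have "cnj (z $ 2) * z $ 3 = of_real (\<beta> * \<gamma>)"
    unfolding uu by simp
  then have ell': "\<beta>\<^sup>2 + \<gamma>\<^sup>2 + \<beta> * \<gamma> = 1 / 2"
    using ell(2) unfolding nb nc by simp
  have na: "(cmod (z $ 1))\<^sup>2 = 1 / 2 + \<beta> * \<gamma>"
    using norm_vec3_sq[of z] z ell' unfolding nb nc by simp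
  \<comment> \<open>This is the sphere equation for the moments. With t =
    \<open>\<beta> * \<gamma>\<close>, the last two moments have sum 1/2 - t and product t^2, so t
    cancels.\<close>
  have "(1 / 2 + \<beta> * \<gamma>)\<^sup>2 + (\<beta>\<^sup>2)\<^sup>2 + (\<gamma>\<^sup>2)\<^sup>2 = 1 / 2"
  proof -
    have "(1 / 2 + \<beta> * \<gamma>)\<^sup>2 + (\<beta>\<^sup>2)\<^sup>2 + (\<gamma>\<^sup>2)\<^sup>2
        = (1 / 2 + \<beta> * \<gamma>)\<^sup>2 + (\<beta>\<^sup>2 + \<gamma>\<^sup>2)\<^sup>2 - 2 * (\<beta> * \<gamma>)\<^sup>2"
      by (simp add: power2_eq_square algebra_simps)
    also have "\<beta>\<^sup>2 + \<gamma>\<^sup>2 = 1 / 2 - \<beta> * \<gamma>"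
      using ell' by simp
    finally show ?thesis
      by (simp add: power2_eq_square algebra_simps)
  qed
  then show "moment_map (cp2_point z) \<in> circle_C"
    using ell' by (simp add: moment_map_unit[OF z] circle_C_def na nb nc)
  obtain \<phi> where \<phi>: "\<phi> \<in> {-(pi/2)<..pi/2}"
    and \<beta>: "\<beta> = sqrt (2 / 3) * cos (\<phi> + 2 / 3 * pi)"
    and \<gamma>: "\<gamma> = sqrt (2 / 3) * cos (\<phi> + 4 / 3 * pi)"
    and sum: "sqrt (2 / 3) * cos \<phi> = - (\<beta> + \<gamma>)"
    using ellipse_angle[OF ell' sign] .
  \<comment> \<open>Dividing \<open>z\<close> by \<open>u\<close> makes the last two coordinates
    real, so the remaining phase sits in the first one. If that coordinate is 0, \<open>Arg\<close>
    returns 0, which lies in the required range.\<close>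
  define \<sigma> where "\<sigma> = Arg (cnj u * z $ 1)"
  \<comment> \<open>The ellipse equation says that \<open>1 / 2 + \<beta> * \<gamma>\<close> is the
    square of \<open>\<beta> + \<gamma>\<close>; \<open>sign\<close> then picks the nonnegative
    root.\<close>
  have "(cmod (z $ 1))\<^sup>2 = (- (\<beta> + \<gamma>))\<^sup>2"
    unfolding na using ell' by (simp add: power2_eq_square algebra_simps)
  then have "cmod (z $ 1) = - (\<beta> + \<gamma>)"
    by (rule power2_eq_imp_eq) (use sign in auto)
  then have "cmod (cnj u * z $ 1) = sqrt (2 / 3) * cos \<phi>"
    using sum u by (simp add: norm_mult)
  then have "cnj u * z $ 1 = of_real (sqrt (2 / 3) * cos \<phi>) * cis \<sigma>"
    using rcis_cmod_Arg[of "cnj u * z $ 1"] by (simp add: rcis_def \<sigma>_def)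
  then have "u * (cnj u * z $ 1) = u * (of_real (sqrt (2 / 3) * cos \<phi>) * cis \<sigma>)"
    by simp
  then have a: "z $ 1 = u * (of_real (sqrt (2 / 3) * cos \<phi>) * cis \<sigma>)"
    by (simp add: uu flip: mult.assoc)
  have zu: "z = u *s z_param \<sigma> \<phi>"
    unfolding vec_eq_iff forall_3 using a b c
    by (simp add: z_param_def \<beta> \<gamma> cis_conv_exp mult_ac)
  then have n: "norm (z_param \<sigma> \<phi>) = 1"
    using z u by (simp add: norm_smult_vec3)
  moreover have "cp2_point z = cp2_point (z_param \<sigma> \<phi>)"
    using zu n z by (subst cp2_point_eq_iff) auto
  moreover have "\<sigma> \<in> {-pi<..pi}"
    using Arg_bounded by (auto simp: \<sigma>_def)
  ultimately show "\<exists>\<sigma>\<in>{-pi<..pi}. \<exists>\<phi>\<in>{-(pi/2)<..pi/2}.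
           norm (z_param \<sigma> \<phi>) = 1 \<and> cp2_point z = cp2_point (z_param \<sigma> \<phi>)"
    using \<phi> by blast
qed

section \<open>From representatives to points of the SIC set\<close>

text \<open>Unit representatives of one point differ by a phase, which the modulus ignores. This
  carries distances from the representatives supplied by \<open>SIC_set\<close> over to
  \<open>z1\<close> and \<open>z2\<close>.\<close>

lemma cmod_herm_cong:
  assumes "norm v = 1" "norm w = 1" "norm v' = 1" "norm w' = 1"
    and "cp2_point v = cp2_point v'" "cp2_point w = cp2_point w'"
  shows "cmod (herm v w) = cmod (herm v' w')"
proof -
  have "v \<noteq> 0" "w \<noteq> 0" "v' \<noteq> 0" "w' \<noteq> 0"
    using assms by auto
  then obtain c d where cd: "v = c *s v'" "w = d *s w'"
    using assms(5,6) cp2_point_eq_iff by blast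
  moreover have "cmod c = 1" "cmod d = 1"
    using assms(1-4) by (simp_all add: cd norm_smult_vec3)
  ultimately show ?thesis
    by (simp add: herm_smult norm_mult)
qed

theorem lemma6p1:
  fixes S :: "cp2 set"
  assumes "SIC_set S"
    and "cp2_point z1 \<in> S" and "cp2_point z2 \<in> S"
  shows "\<forall>p \<in> S - {cp2_point z1, cp2_point z2}.
           moment_map p \<in> circle_C \<and>
           (\<exists>\<sigma>\<in>{-pi<..pi}. \<exists>\<phi>\<in>{-(pi/2)<..pi/2}.
              norm (z_param \<sigma> \<phi>) = 1 \<and> p = cp2_point (z_param \<sigma> \<phi>))"
proof
  fix p assume p: "p \<in> S - {cp2_point z1, cp2_point z2}"
  obtain z :: "nat \<Rightarrow> complex ^ 3" and \<kappa> where unit: "\<forall>i\<in>{1..9}. norm (z i) = 1"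
    and S: "S = (\<lambda>i. cp2_point (z i)) ` {1..9}"
    and dist: "\<forall>i\<in>{1..9}. \<forall>j\<in>{1..9}. i \<noteq> j \<longrightarrow> (cmod (herm (z i) (z j)))\<^sup>2 = \<kappa>"
    using assms(1) unfolding SIC_set_def by (elim exE conjE) (rule that)
  \<comment> \<open>The indexed condition becomes one on points: distinct points have distinct
    indices.\<close>
  have eq: "(cmod (herm v w))\<^sup>2 = \<kappa>"
    if vw: "norm v = 1" "norm w = 1" "cp2_point v \<in> S" "cp2_point w \<in> S" "cp2_point v \<noteq> cp2_point w"
    for v w
  proof -
    obtain i j where ij: "i \<in> {1..9}" "j \<in> {1..9}" "cp2_point v = cp2_point (z i)"
      "cp2_point w = cp2_point (z j)"
      using vw(3,4) unfolding S by blast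
    have "i \<noteq> j"
      using vw(5) ij by auto
    then have "(cmod (herm (z i) (z j)))\<^sup>2 = \<kappa>"
      using dist ij(1,2) by blast
    moreover have "cmod (herm v w) = cmod (herm (z i) (z j))"
      using vw(1,2) ij unit by (intro cmod_herm_cong) simp_all
    ultimately show ?thesis
      by simp
  qed
  have "\<kappa> = 1 / 4"
    using eq[OF norm_z1 norm_z2 assms(2,3) cp2_point_z1_neq_z2] cmod_herm_z1_z2_sq by simp
  moreover obtain v where v: "norm v = 1" "p = cp2_point v"
    using p unit unfolding S by blast
  ultimately have "(cmod (herm z1 v))\<^sup>2 = 1 / 4" "(cmod (herm z2 v))\<^sup>2 = 1 / 4"
    using eq[OF norm_z1 v(1) assms(2)] eq[OF norm_z2 v(1) assms(3)] p by auto
  then show "moment_map p \<in> circle_C \<and>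
           (\<exists>\<sigma>\<in>{-pi<..pi}. \<exists>\<phi>\<in>{-(pi/2)<..pi/2}.
              norm (z_param \<sigma> \<phi>) = 1 \<and> p = cp2_point (z_param \<sigma> \<phi>))"
    using equidistant_from_z1_z2[OF v(1)] unfolding v(2) by blast
qed

end
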